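(* Let $W,H$ be real Hilbert spaces with a dense and continuous inclusion $W\hookrightarrow H$, let $I=[0,1]$, and let $\mathcal{A}:I\rightarrow\mathcal{FS}(W,H)\subset\mathcal{L}(W,H)$ be a continuously differentiable path. Then there exists $\varepsilon>0$ such that i) $\mathcal{A}+\delta I_H$ is a path in $\mathcal{FS}(W,H)$ for all $|\delta|<\varepsilon$; ii) $\mathcal{A}+\delta I_H$ has only regular crossings for almost every $\delta\in(-\varepsilon,\varepsilon)$.
   Context: $\mathcal{L}(W,H)$ is the Banach space of bounded operators from $W$ to $H$; $\mathcal{FS}(W,H)\subset\mathcal{L}(W,H)$ is the set of those operators that are selfadjoint when regarded as operators on $H$ with dense domain $W$, and Fredholm. $I_H$ is the identity of $H$ (viewed, by restriction to $W$, as an element of $\mathcal{L}(W,H)$), and $(\mathcal{A}+\delta I_H)_t=\mathcal{A}_t+\delta I_H$. "Almost every" is with respect to Lebesgue measure. For a continuously differentiable path $\mathcal{A}:I\to\mathcal{FS}(W,H)$ with derivative $\dot{\mathcal{A}}_{t}$, an instant $t_0\in I$ is a crossing if $\ker\mathcal{A}_{t_0}\neq0$. The crossing form at $t_0$ is the quadratic form $\Gamma(\mathcal{A},t_0):\ker\mathcal{A}_{t_0}\to\mathbb{R}$, $\Gamma(\mathcal{A},t_0)[u]=\langle\dot{\mathcal{A}}_{t_0}u,u\rangle_H$. A crossing $t_0$ is regular if $\Gamma(\mathcal{A},t_0)$ is non-degenerate. *)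

theory Defs
  imports "HOL-Analysis.Analysis"
begin

text \<open>
  The continuous inclusion of \<open>W\<close> into \<open>H\<close> is an injective bounded linear map
  \<open>j :: 'w \<Rightarrow>\<^sub>L 'h\<close>, whose range is \<open>W\<close> as a subset of \<open>H\<close>. An element \<open>T\<close> of \<open>L(W,H)\<close>,
  regarded as an operator on \<open>H\<close> with domain \<open>W\<close>, is then represented by its graph
  in \<open>H \<times> H\<close>; the identity of \<open>H\<close>, restricted to \<open>W\<close>, is \<open>j\<close> itself.
\<close>

definition op_graph :: "('w::real_inner \<Rightarrow>\<^sub>L 'h::real_inner) \<Rightarrow> ('w \<Rightarrow>\<^sub>L 'h) \<Rightarrow> ('h \<times> 'h) set" where
  "op_graph j T = {(blinfun_apply j u, blinfun_apply T u) | u. True}"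

text \<open>
  If the domain of the operator with graph \<open>G\<close> is dense, this is the graph of its
  Hilbert space adjoint: \<open>v\<close> is in the domain of the adjoint, with value \<open>z\<close>, iff
  \<open>\<langle>Tx, v\<rangle> = \<langle>x, z\<rangle>\<close> for all \<open>x\<close> in the domain of \<open>T\<close>.
\<close>

definition adjoint_graph :: "('h::real_inner \<times> 'h) set \<Rightarrow> ('h \<times> 'h) set" where
  "adjoint_graph G = {(v, z). \<forall>(x, y) \<in> G. y \<bullet> v = x \<bullet> z}"

definition selfadjoint_op :: "('w::real_inner \<Rightarrow>\<^sub>L 'h::real_inner) \<Rightarrow> ('w \<Rightarrow>\<^sub>L 'h) \<Rightarrow> bool" where
  "selfadjoint_op j T \<longleftrightarrow> adjoint_graph (op_graph j T) = op_graph j T"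

definition blinfun_kernel :: "('a::real_normed_vector \<Rightarrow>\<^sub>L 'b::real_normed_vector) \<Rightarrow> 'a set" where
  "blinfun_kernel T = {u. blinfun_apply T u = 0}"

text \<open>
  Finite-dimensional kernel, closed range, finite-dimensional cokernel. Between Banach
  spaces closedness of the range follows from the other two conditions.
\<close>

definition fredholm :: "('a::real_normed_vector \<Rightarrow>\<^sub>L 'b::real_normed_vector) \<Rightarrow> bool" where
  "fredholm T \<longleftrightarrow>
     (\<exists>B. finite B \<and> span B = blinfun_kernel T) \<and>
     closed (range (blinfun_apply T)) \<and>
     (\<exists>C. finite C \<and> span (range (blinfun_apply T) \<union> C) = UNIV)"

definition FS :: "('w::real_inner \<Rightarrow>\<^sub>L 'h::real_inner) \<Rightarrow> ('w \<Rightarrow>\<^sub>L 'h) set" where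
  "FS j = {T. selfadjoint_op j T \<and> fredholm T}"

text \<open>
  One-sided derivatives at the endpoints; the library's \<open>C1_differentiable_on\<close> would
  instead depend on values of the path outside the unit interval.
\<close>

definition C1_path :: "(real \<Rightarrow> 'a::real_normed_vector) \<Rightarrow> bool" where
  "C1_path A \<longleftrightarrow>
     (\<exists>A'. (\<forall>t\<in>{0..1}. (A has_vector_derivative A' t) (at t within {0..1})) \<and>
           continuous_on {0..1} A')"

definition path_deriv :: "(real \<Rightarrow> 'a::real_normed_vector) \<Rightarrow> real \<Rightarrow> 'a" where
  "path_deriv A t = vector_derivative A (at t within {0..1})"

definition crossing :: "(real \<Rightarrow> 'w::real_inner \<Rightarrow>\<^sub>L 'h::real_inner) \<Rightarrow> real \<Rightarrow> bool" where
  "crossing A t \<longleftrightarrow> t \<in> {0..1} \<and> blinfun_kernel (A t) \<noteq> {0}"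

definition crossing_form ::
  "('w::real_inner \<Rightarrow>\<^sub>L 'h::real_inner) \<Rightarrow> (real \<Rightarrow> 'w \<Rightarrow>\<^sub>L 'h) \<Rightarrow> real \<Rightarrow> 'w \<Rightarrow> real" where
  "crossing_form j A t u = blinfun_apply (path_deriv A t) u \<bullet> blinfun_apply j u"

text \<open>
  The polar form of a quadratic form, and non-degeneracy on a subspace as triviality
  of the radical of the polar form.
\<close>

definition polar_form :: "('a::real_vector \<Rightarrow> real) \<Rightarrow> 'a \<Rightarrow> 'a \<Rightarrow> real" where
  "polar_form Q u v = (Q (u + v) - Q u - Q v) / 2"

definition nondegenerate_on :: "'a::real_vector set \<Rightarrow> ('a \<Rightarrow> real) \<Rightarrow> bool" where
  "nondegenerate_on V Q \<longleftrightarrow> (\<forall>u\<in>V. (\<forall>v\<in>V. polar_form Q u v = 0) \<longrightarrow> u = 0)"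

definition regular_crossing ::
  "('w::real_inner \<Rightarrow>\<^sub>L 'h::real_inner) \<Rightarrow> (real \<Rightarrow> 'w \<Rightarrow>\<^sub>L 'h) \<Rightarrow> real \<Rightarrow> bool" where
  "regular_crossing j A t \<longleftrightarrow>
     crossing A t \<and> nondegenerate_on (blinfun_kernel (A t)) (crossing_form j A t)"

definition only_regular_crossings ::
  "('w::real_inner \<Rightarrow>\<^sub>L 'h::real_inner) \<Rightarrow> (real \<Rightarrow> 'w \<Rightarrow>\<^sub>L 'h) \<Rightarrow> bool" where
  "only_regular_crossings j A \<longleftrightarrow> (\<forall>t. crossing A t \<longrightarrow> regular_crossing j A t)"

definition shift_path ::
  "('w::real_inner \<Rightarrow>\<^sub>L 'h::real_inner) \<Rightarrow> (real \<Rightarrow> 'w \<Rightarrow>\<^sub>L 'h) \<Rightarrow> real \<Rightarrow> (real \<Rightarrow> 'w \<Rightarrow>\<^sub>L 'h)" where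
  "shift_path j A \<delta> = (\<lambda>t. A t + \<delta> *\<^sub>R j)"

end

theory Submission
  imports Defs
begin

text \<open>
  The Fredholm operators form an open set, so by compactness of the path there is a uniform
  \<open>\<epsilon>\<close>; shifting by \<open>\<delta>\<close> preserves selfadjointness.

  For (ii), no spectral decomposition is needed. Let \<open>G\<close> be the set of \<open>(t, \<delta>)\<close> for which
  \<open>A\<^sub>t + \<delta>\<close> has a kernel vector \<open>u \<noteq> 0\<close> with \<open>\<langle>A'\<^sub>t u, u\<rangle> = 0\<close>; every \<open>\<delta>\<close> with a degenerate
  crossing lies in the second projection of \<open>G\<close>. If points \<open>(s, d)\<close> of \<open>G\<close>, with unit kernel
  vectors \<open>u\<^sub>s\<close>, tend to \<open>(t, \<delta>)\<close>, the Fredholm property makes a subsequence of \<open>u\<^sub>s\<close> converge to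
  some \<open>l\<close> in the kernel of \<open>A\<^sub>t + \<delta>\<close>, and by symmetry
  \<open>\<langle>(A\<^sub>s - A\<^sub>t) u\<^sub>s, l\<rangle> = - (d - \<delta>) \<langle>u\<^sub>s, l\<rangle>\<close>. Since \<open>\<langle>A'\<^sub>t l, l\<rangle> = lim \<langle>A'\<^sub>s u\<^sub>s, u\<^sub>s\<rangle> = 0\<close>, the
  function \<open>(t, \<delta>) \<mapsto> \<delta>\<close> has derivative zero within \<open>G\<close>. Hence \<open>G\<close> is a countable union of
  graphs of functions of \<open>t\<close> with vanishing derivative, whose images are null sets by Sard's
  lemma.
\<close>

section \<open>Finite-dimensional subspaces\<close>

lemma closed_if_compact_Int_cball:
  fixes S :: "'a::metric_space set"
  assumes "\<And>r. compact (cball a r \<inter> S)"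
  shows "closed S"
  unfolding closed_sequential_limits
proof (intro allI impI, elim conjE)
  fix x l
  assume x: "\<forall>n. x n \<in> S" and lim: "x \<longlonglongrightarrow> l"
  obtain r where "\<And>n. dist a (x n) \<le> r"
    using convergent_imp_bounded[OF lim] bounded_any_center[of "range x" a] by auto
  then have "x n \<in> cball a r \<inter> S" for n
    using x by simp
  then have "l \<in> cball a r \<inter> S"
    using lim by (rule closed_sequentially[OF compact_imp_closed[OF assms]])
  then show "l \<in> S"
    by blast
qed

lemma infdist_subspace_le_norm_add:
  fixes V :: "'a::real_normed_vector set"
  assumes "subspace V" "y \<in> V"
  shows "\<bar>c\<bar> * infdist b V \<le> norm (c *\<^sub>R b + y)"
proof (cases "c = 0")
  case False
  have "- (y /\<^sub>R c) \<in> V"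
    using assms by (intro subspace_neg subspace_scale)
  then have "\<bar>c\<bar> * infdist b V \<le> \<bar>c\<bar> * dist b (- (y /\<^sub>R c))"
    by (intro mult_left_mono infdist_le) auto
  also have "\<dots> = norm (c *\<^sub>R (b + y /\<^sub>R c))"
    by (simp add: dist_norm)
  finally show ?thesis
    using False by (simp add: scaleR_add_right)
qed simp

definition slab :: "'a::real_normed_vector \<Rightarrow> real \<Rightarrow> 'a set \<Rightarrow> 'a set" where
  "slab b K Y = (\<lambda>(c, y). c *\<^sub>R b + y) ` ({-K..K} \<times> Y)"

lemma compact_slab: "compact Y \<Longrightarrow> compact (slab b K Y)"
  unfolding slab_def case_prod_unfold
  by (intro compact_continuous_image compact_Times continuous_intros) simp_all

lemma slab_subset_span_insert:
  assumes "Y \<subseteq> span B"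
  shows "slab b K Y \<subseteq> span (insert b B)"
  using assms span_mono[OF subset_insertI[of B b]] unfolding slab_def
  by (auto intro!: span_add intro: span_scale span_base)

lemma cball_Int_span_insert_subset_slab:
  fixes B :: "'a::real_normed_vector set"
  assumes "closed (span B)" "b \<notin> span B"
  obtains K where "cball 0 r \<inter> span (insert b B) \<subseteq> slab b K (cball 0 (r + K * norm b) \<inter> span B)"
proof
  define d where "d = infdist b (span B)"
  have "d > 0"
    unfolding d_def using assms span_zero by (intro infdist_pos_not_in_closed) auto
  show "cball 0 r \<inter> span (insert b B) \<subseteq> slab b (r / d) (cball 0 (r + r / d * norm b) \<inter> span B)"
  proof
    fix x
    assume x: "x \<in> cball 0 r \<inter> span (insert b B)"
    then obtain c where y: "x - c *\<^sub>R b \<in> span B"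
      using span_breakdown_eq by blast
    have "\<bar>c\<bar> * d \<le> norm x"
      using infdist_subspace_le_norm_add[OF subspace_span y, of c b] by (simp add: d_def)
    then have c: "\<bar>c\<bar> \<le> r / d"
      using x \<open>d > 0\<close> by (simp add: field_simps)
    have "norm (x - c *\<^sub>R b) \<le> norm x + \<bar>c\<bar> * norm b"
      by (metis norm_scaleR norm_triangle_ineq4)
    also have "\<dots> \<le> r + r / d * norm b"
      using x c by (intro add_mono mult_right_mono) auto
    finally show "x \<in> slab b (r / d) (cball 0 (r + r / d * norm b) \<inter> span B)"
      using y c unfolding slab_def by (intro image_eqI[of _ _ "(c, x - c *\<^sub>R b)"]) auto
  qed
qed

lemma compact_cball_Int_span:
  fixes B :: "'a::real_normed_vector set"
  assumes "finite B"
  shows "compact (cball 0 r \<inter> span B)"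
  using assms
proof (induction B arbitrary: r rule: finite_induct)
  case empty
  then show ?case
    by (simp add: closed_Int_compact)
next
  case (insert b B)
  show ?case
  proof (cases "b \<in> span B")
    case True
    then show ?thesis
      using insert.IH by (simp add: span_redundant)
  next
    case False
    obtain K where subset:
      "cball 0 r \<inter> span (insert b B) \<subseteq> slab b K (cball 0 (r + K * norm b) \<inter> span B)"
      using closed_if_compact_Int_cball[OF insert.IH] False
      by (rule cball_Int_span_insert_subset_slab)
    let ?S = "slab b K (cball 0 (r + K * norm b) \<inter> span B)"
    have "cball 0 r \<inter> span (insert b B) = cball 0 r \<inter> ?S"
      using subset slab_subset_span_insert[of "cball 0 (r + K * norm b) \<inter> span B" B b K] by auto
    moreover have "compact ?S"
      by (rule compact_slab[OF insert.IH])
    ultimately show ?thesis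
      by (simp add: closed_Int_compact)
  qed
qed

lemma closed_span_finite:
  fixes B :: "'a::real_normed_vector set"
  assumes "finite B"
  shows "closed (span B)"
  using compact_cball_Int_span[OF assms] by (rule closed_if_compact_Int_cball)

lemma bounded_sequence_near_finite_span_subsequence:
  fixes B :: "'a::real_normed_vector set" and u v :: "nat \<Rightarrow> 'a"
  assumes "finite B" and v: "\<And>n. v n \<in> span B"
    and u: "\<And>n. norm (u n) \<le> M" and near: "(\<lambda>n. u n - v n) \<longlonglongrightarrow> 0"
  obtains l r where "l \<in> span B" "strict_mono r" "(u \<circ> r) \<longlonglongrightarrow> l"
proof -
  obtain c where c: "\<And>n. norm (u n - v n) \<le> c"
    using convergent_imp_bounded[OF near] unfolding bounded_iff by auto
  have "norm (v n) \<le> M + c" for n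
    using norm_triangle_ineq4[of "u n" "u n - v n"] u[of n] c[of n] by simp
  then have "\<forall>n. v n \<in> cball 0 (M + c) \<inter> span B"
    using v by simp
  then obtain l r where l: "l \<in> cball 0 (M + c) \<inter> span B" and r: "strict_mono r" "(v \<circ> r) \<longlonglongrightarrow> l"
    by (rule seq_compactE[OF compact_imp_seq_compact[OF compact_cball_Int_span[OF \<open>finite B\<close>]]])
  have "(u \<circ> r) \<longlonglongrightarrow> l"
    using tendsto_add[OF LIMSEQ_subseq_LIMSEQ[OF near r(1)] r(2)] by (simp add: o_def)
  with IntD2[OF l] r(1) show thesis
    by (rule that)
qed

lemma finite_dim_if_linear_inj_on:
  assumes "linear f" "subspace V" "inj_on f V" "f ` V \<subseteq> span B" "finite B"
  shows "\<exists>D. finite D \<and> span D = V"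
proof -
  obtain g where g: "range g \<subseteq> V" "linear g" "\<And>v. v \<in> V \<Longrightarrow> g (f v) = v"
    using real_vector.linear_exists_left_inverse_on[OF assms(1-3)] by blast
  have "span (g ` B) = g ` span B"
    by (rule linear_span_image[OF g(2)])
  also have "\<dots> = V"
    using g(1,3) assms(4) by (force simp: image_iff)
  finally show ?thesis
    using assms(5) by blast
qed

lemma finite_dim_if_close_to_finite_span:
  fixes V B :: "'a::real_inner set"
  assumes V: "subspace V" and B: "finite B"
    and close: "\<And>u. u \<in> V \<Longrightarrow> u \<noteq> 0 \<Longrightarrow> \<exists>v\<in>span B. norm (u - v) < norm u"
  shows "\<exists>D. finite D \<and> span D = V"
proof -
  \<comment> \<open>The frame operator of \<open>B\<close> is injective on \<open>V\<close>: no nonzero vector of \<open>V\<close> is orthogonal to \<open>B\<close>.\<close>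
  define f where "f u = (\<Sum>b\<in>B. (u \<bullet> b) *\<^sub>R b)" for u
  have "linear f"
    unfolding f_def
    by (intro linearI) (simp_all add: inner_add_left scaleR_add_left sum.distrib scaleR_sum_right)
  moreover have "f ` V \<subseteq> span B"
    unfolding f_def by (auto intro!: span_sum intro: span_scale span_base)
  moreover have "u = 0" if u: "u \<in> V" "f u = 0" for u
  proof (rule ccontr)
    assume "u \<noteq> 0"
    have "(\<Sum>b\<in>B. (u \<bullet> b)\<^sup>2) = u \<bullet> f u"
      by (simp add: f_def inner_sum_right power2_eq_square)
    then have "\<And>b. b \<in> B \<Longrightarrow> orthogonal u b"
      using u(2) B by (simp add: sum_nonneg_eq_0_iff orthogonal_def)
    then have orth: "orthogonal u v" if "v \<in> span B" for v
      using that by (rule orthogonal_to_span[rotated])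
    obtain v where v: "v \<in> span B" "norm (u - v) < norm u"
      using close u(1) \<open>u \<noteq> 0\<close> by blast
    have "norm u * norm u = u \<bullet> (u - v)"
      using orth[OF v(1)]
      by (simp add: inner_diff_right orthogonal_def dot_square_norm power2_eq_square)
    also have "\<dots> \<le> norm u * norm (u - v)"
      by (rule norm_cauchy_schwarz)
    finally show False
      using v(2) \<open>u \<noteq> 0\<close> by simp
  qed
  then have "inj_on f V"
    using \<open>linear f\<close> V by (simp add: linear_inj_on_iff_eq_0)
  ultimately show ?thesis
    using V B by (intro finite_dim_if_linear_inj_on[of f])
qed

lemma finite_minimal_subset:
  assumes "finite C" "P C"
  obtains D where "D \<subseteq> C" "P D" "\<forall>E\<subseteq>D. P E \<longrightarrow> E = D"
proof -
  let ?\<D> = "{D. D \<subseteq> C \<and> P D}"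
  have "finite ?\<D>" "C \<in> ?\<D>"
    using assms by simp_all
  then obtain D where D: "D \<in> ?\<D>" and minimal: "\<forall>E\<in>?\<D>. E \<subseteq> D \<longrightarrow> D = E"
    using finite_has_minimal2 by meson
  show thesis
  proof (rule that)
    show "\<forall>E\<subseteq>D. P E \<longrightarrow> E = D"
      using minimal D by auto
  qed (use D in auto)
qed

lemma nonzero_in_span_exchange:
  fixes v :: "'a::real_vector"
  assumes "finite D" "v \<in> span D" "v \<noteq> 0"
  obtains b where "b \<in> D" "b \<in> span (insert v (D - {b}))"
proof -
  obtain E where E: "E \<subseteq> D" "v \<in> span E" and minimal: "\<forall>F\<subseteq>E. v \<in> span F \<longrightarrow> F = E"
    using assms(1,2) by (rule finite_minimal_subset[where P = "\<lambda>E. v \<in> span E"])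
  obtain b where b: "b \<in> E"
    using E(2) \<open>v \<noteq> 0\<close> by fastforce
  then have "v \<notin> span (E - {b})"
    using minimal by blast
  then have "b \<in> span (insert v (E - {b}))"
    using E(2) by (rule in_span_delete[rotated])
  moreover have "span (insert v (E - {b})) \<subseteq> span (insert v (D - {b}))"
    using E(1) by (intro span_mono) blast
  ultimately show thesis
    using that b E(1) by blast
qed

lemma complement_subset_of_finite_spanning_set:
  fixes R C :: "'a::real_vector set"
  assumes "finite C" "span (R \<union> C) = UNIV" "subspace R"
  obtains D where "D \<subseteq> C" "span (R \<union> D) = UNIV" "R \<inter> span D = {0}"
proof -
  obtain D where D: "D \<subseteq> C" "span (R \<union> D) = UNIV"
    and minimal: "\<forall>E\<subseteq>D. span (R \<union> E) = UNIV \<longrightarrow> E = D"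
    using assms(1,2) by (rule finite_minimal_subset[where P = "\<lambda>E. span (R \<union> E) = UNIV"])
  have "v = 0" if v: "v \<in> R" "v \<in> span D" for v
  proof (rule ccontr)
    assume "v \<noteq> 0"
    then obtain b where b: "b \<in> D" "b \<in> span (insert v (D - {b}))"
      using nonzero_in_span_exchange[OF finite_subset[OF D(1) assms(1)] v(2)] by metis
    have "span (insert v (D - {b})) \<subseteq> span (R \<union> (D - {b}))"
      using v(1) by (intro span_mono) blast
    with b(2) have "span (insert b (R \<union> (D - {b}))) = span (R \<union> (D - {b}))"
      by (intro span_redundant) blast
    moreover have "insert b (R \<union> (D - {b})) = R \<union> D"
      using b(1) by blast
    ultimately have "D - {b} = D"
      using D(2) minimal by (metis Diff_subset)
    then show False
      using b(1) by blast
  qed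
  then have "R \<inter> span D = {0}"
    using assms(3) span_zero subspace_0 by blast
  with D show thesis
    by (rule that)
qed

section \<open>Bounded solutions modulo a subspace\<close>

definition lifts_modulo ::
  "('a::real_normed_vector \<Rightarrow>\<^sub>L 'b::real_normed_vector) \<Rightarrow> 'b set \<Rightarrow> real \<Rightarrow> bool" where
  "lifts_modulo T M K \<longleftrightarrow> (\<forall>y. \<exists>x. y - T x \<in> M \<and> norm x \<le> K * norm y)"

lemma lifts_moduloE:
  assumes "lifts_modulo T M K"
  obtains x where "y - T x \<in> M" "norm x \<le> K * norm y"
  using assms unfolding lifts_modulo_def by blast

definition approx_lifts_modulo ::
  "('a::real_normed_vector \<Rightarrow>\<^sub>L 'b::real_normed_vector) \<Rightarrow> 'b set \<Rightarrow> real \<Rightarrow> bool" where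
  "approx_lifts_modulo T M K \<longleftrightarrow>
     (\<forall>y. \<exists>x. \<exists>m\<in>M. norm x \<le> K * norm y \<and> norm (y - T x - m) \<le> norm y / 2)"

lemma sums_if_norm_le_geometric:
  fixes f :: "nat \<Rightarrow> 'a::banach"
  assumes bound: "\<And>n. norm (f n) \<le> c * q ^ n" and "\<bar>q\<bar> < 1"
  obtains x where "f sums x" "norm x \<le> c / (1 - q)"
proof
  have geometric: "(\<lambda>n. c * q ^ n) sums (c / (1 - q))"
    using sums_mult[OF geometric_sums[of q], of c] \<open>\<bar>q\<bar> < 1\<close> by simp
  show "f sums suminf f"
    by (intro summable_sums summable_comparison_test'[OF sums_summable[OF geometric]] bound)
  show "norm (suminf f) \<le> c / (1 - q)"
    unfolding sums_unique[OF geometric]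
    by (rule norm_suminf_le[OF bound sums_summable[OF geometric]])
qed

lemma lifts_modulo_if_approx_lifts_modulo:
  fixes T :: "'a::banach \<Rightarrow>\<^sub>L 'b::real_normed_vector"
  assumes M: "subspace M" "closed M" and approx: "approx_lifts_modulo T M k" and "k \<ge> 0"
  shows "lifts_modulo T M (2 * k)"
  unfolding lifts_modulo_def
proof
  fix y
  obtain X m where m: "\<And>y. m y \<in> M" and X: "\<And>y. norm (X y) \<le> k * norm y"
    and residual: "\<And>y. norm (y - T (X y) - m y) \<le> norm y / 2"
    using approx unfolding approx_lifts_modulo_def by metis
  define z where "z n = ((\<lambda>y. y - T (X y) - m y) ^^ n) y" for n
  have z_0: "z 0 = y" and z_Suc: "z (Suc n) = z n - T (X (z n)) - m (z n)" for n
    by (simp_all add: z_def)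
  have norm_z: "norm (z n) \<le> norm y * (1/2) ^ n" for n
  proof (induction n)
    case (Suc n)
    then show ?case
      using residual[of "z n"] by (simp add: z_Suc)
  qed (simp add: z_0)
  have norm_X: "norm (X (z n)) \<le> k * norm y * (1/2) ^ n" for n
    using X[of "z n"] mult_left_mono[OF norm_z[of n] \<open>k \<ge> 0\<close>] by (simp add: mult.assoc)
  obtain x where x: "(\<lambda>n. X (z n)) sums x" and "norm x \<le> k * norm y / (1 - 1 / 2)"
    using norm_X by (rule sums_if_norm_le_geometric) simp
  then have norm_x: "norm x \<le> 2 * k * norm y"
    by simp
  have partial: "y - T (\<Sum>i<n. X (z i)) - z n \<in> M" for n
  proof (induction n)
    case (Suc n)
    have step: "y - T (\<Sum>i<Suc n. X (z i)) - z (Suc n) = y - T (\<Sum>i<n. X (z i)) - z n + m (z n)"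
      by (simp add: z_Suc blinfun.add_right)
    show ?case
      unfolding step using M(1) Suc m by (rule subspace_add)
  qed (simp add: z_0 subspace_0[OF M(1)])
  have "(\<lambda>n. norm y * (1/2) ^ n) \<longlonglongrightarrow> 0"
    by (intro tendsto_mult_right_zero LIMSEQ_power_zero) simp
  then have "z \<longlonglongrightarrow> 0"
    by (rule Lim_null_comparison[rotated]) (simp add: norm_z)
  with x have "(\<lambda>n. y - T (\<Sum>i<n. X (z i)) - z n) \<longlonglongrightarrow> y - T x - 0"
    unfolding sums_def by (intro tendsto_diff tendsto_const blinfun.tendsto)
  then have "y - T x - 0 \<in> M"
    by (rule closed_sequentially[OF M(2), rotated]) (simp add: partial)
  with norm_x show "\<exists>x. y - T x \<in> M \<and> norm x \<le> 2 * k * norm y"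
    by auto
qed

lemma lifts_modulo_perturb:
  fixes S T :: "'a::banach \<Rightarrow>\<^sub>L 'b::real_normed_vector"
  assumes M: "subspace M" "closed M" and T: "lifts_modulo T M K" "K \<ge> 0"
    and small: "norm (S - T) * K \<le> 1 / 2"
  shows "lifts_modulo S M (2 * K)"
proof (rule lifts_modulo_if_approx_lifts_modulo[OF M _ T(2)], unfold approx_lifts_modulo_def, rule)
  fix y
  obtain x where x: "y - T x \<in> M" "norm x \<le> K * norm y"
    using T(1) by (rule lifts_moduloE)
  have "norm (y - S x - (y - T x)) = norm ((S - T) x)"
    by (simp add: blinfun.diff_left norm_minus_commute)
  also have "\<dots> \<le> norm (S - T) * (K * norm y)"
    using x(2) by (meson mult_left_mono norm_blinfun norm_ge_zero order_trans)
  also have "\<dots> \<le> norm y / 2"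
    using mult_right_mono[OF small, of "norm y"] by (simp add: mult.assoc)
  finally show "\<exists>x. \<exists>m\<in>M. norm x \<le> K * norm y \<and> norm (y - S x - m) \<le> norm y / 2"
    using x by blast
qed

lemma Baire_countable_cover:
  fixes P :: "nat \<Rightarrow> 'a::complete_space set"
  assumes "(\<Union>n. P n) = UNIV"
  shows "\<exists>n. interior (closure (P n)) \<noteq> {}"
proof (rule ccontr)
  assume "\<not> ?thesis"
  then have "(euclidean :: 'a topology) interior_of \<Union> (range (\<lambda>n. closure (P n))) = {}"
    by (intro Baire_category_alt) (auto simp: completely_metrizable_space_euclidean)
  moreover have "\<Union> (range (\<lambda>n. closure (P n))) = UNIV"
    using assms closure_subset by blast
  ultimately show False
    by simp
qed

lemma ball_subset_closure_differences:
  fixes P :: "'a::real_normed_vector set"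
  assumes "ball a r \<subseteq> closure P" "r > 0"
  shows "ball 0 r \<subseteq> closure {p - q | p q. p \<in> P \<and> q \<in> P}"
proof
  fix y :: 'a
  assume "y \<in> ball 0 r"
  then have "a + y \<in> closure P" "a \<in> closure P"
    using assms by (auto simp: dist_norm)
  then obtain p q where "\<forall>n. p n \<in> P" "p \<longlonglongrightarrow> a + y" "\<forall>n. q n \<in> P" "q \<longlonglongrightarrow> a"
    unfolding closure_sequential by blast
  moreover from this have "(\<lambda>n. p n - q n) \<longlonglongrightarrow> y"
    using tendsto_diff[of p "a + y" sequentially q a] by simp
  ultimately show "y \<in> closure {p - q | p q. p \<in> P \<and> q \<in> P}"
    unfolding closure_sequential by (intro exI[of _ "\<lambda>n. p n - q n"]) blast
qed

lemma near_range_modulo_if_ball_subset_closure: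
  fixes T :: "'a::real_normed_vector \<Rightarrow>\<^sub>L 'b::real_normed_vector"
  assumes M: "subspace M" and ball: "ball a r \<subseteq> closure {p. \<exists>x. norm x \<le> s \<and> p - T x \<in> M}" "r > 0"
    and "norm y < r" "e > 0"
  obtains x m where "m \<in> M" "norm x \<le> 2 * s" "norm (y - T x - m) < e"
proof -
  define P where "P = {p. \<exists>x. norm x \<le> s \<and> p - T x \<in> M}"
  have "y \<in> closure {p - q | p q. p \<in> P \<and> q \<in> P}"
    unfolding P_def using \<open>norm y < r\<close>
    by (intro subsetD[OF ball_subset_closure_differences[OF ball]]) simp
  then obtain p q where pq: "p \<in> P" "q \<in> P" and near: "dist (p - q) y < e"
    unfolding closure_approachable using \<open>e > 0\<close> by blast
  obtain v w where v: "norm v \<le> s" "p - T v \<in> M" and w: "norm w \<le> s" "q - T w \<in> M"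
    using pq by (auto simp: P_def)
  show thesis
  proof (rule that)
    show "(p - T v) - (q - T w) \<in> M"
      by (intro subspace_diff M v w)
    show "norm (v - w) \<le> 2 * s"
      using norm_triangle_ineq4[of v w] v(1) w(1) by linarith
    show "norm (y - T (v - w) - ((p - T v) - (q - T w))) < e"
      using near by (simp add: dist_norm norm_minus_commute blinfun.diff_right)
  qed
qed

lemma approx_lifts_modulo_if_ball_subset_closure:
  fixes T :: "'a::real_normed_vector \<Rightarrow>\<^sub>L 'b::real_normed_vector"
  assumes M: "subspace M" and ball: "ball a r \<subseteq> closure {p. \<exists>x. norm x \<le> s \<and> p - T x \<in> M}" "r > 0"
  shows "approx_lifts_modulo T M (4 * s / r)"
  unfolding approx_lifts_modulo_def
proof
  fix y
  show "\<exists>x. \<exists>m\<in>M. norm x \<le> 4 * s / r * norm y \<and> norm (y - T x - m) \<le> norm y / 2"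
  proof (cases "y = 0")
    case True
    then show ?thesis
      by (intro exI[of _ 0] bexI[of _ 0]) (auto simp: subspace_0[OF M])
  next
    case False
    define c where "c = 2 * norm y / r"
    have "c > 0" "norm (y /\<^sub>R c) < r" "r / 4 > 0"
      using False \<open>r > 0\<close> by (simp_all add: c_def)
    then obtain x m where m: "m \<in> M" and x: "norm x \<le> 2 * s"
      and near: "norm (y /\<^sub>R c - T x - m) < r / 4"
      using near_range_modulo_if_ball_subset_closure[OF M ball] by metis
    have "norm (c *\<^sub>R x) \<le> c * (2 * s)"
      using x \<open>c > 0\<close> by simp
    then have "norm (c *\<^sub>R x) \<le> 4 * s / r * norm y"
      by (simp add: c_def mult_ac)
    moreover have "norm (y - T (c *\<^sub>R x) - c *\<^sub>R m) \<le> norm y / 2"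
    proof -
      have "y - T (c *\<^sub>R x) - c *\<^sub>R m = c *\<^sub>R (y /\<^sub>R c - T x - m)"
        using \<open>c > 0\<close> by (simp add: blinfun.scaleR_right scaleR_diff_right)
      then have "norm (y - T (c *\<^sub>R x) - c *\<^sub>R m) \<le> c * (r / 4)"
        using near \<open>c > 0\<close> by simp
      also have "\<dots> = norm y / 2"
        using \<open>r > 0\<close> by (simp add: c_def)
      finally show ?thesis .
    qed
    ultimately show ?thesis
      using subspace_scale[OF M m] by blast
  qed
qed

lemma open_mapping_modulo_subspace:
  fixes T :: "'a::banach \<Rightarrow>\<^sub>L 'b::banach"
  assumes M: "subspace M" "closed M" and onto: "\<And>y. \<exists>x. y - T x \<in> M"
  obtains K where "K > 0" "lifts_modulo T M K"
proof -
  define P where "P s = {p. \<exists>x. norm x \<le> s \<and> p - T x \<in> M}" for s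
  have "y \<in> (\<Union>n. P (real (Suc n)))" for y
  proof -
    obtain x where "y - T x \<in> M"
      using onto by blast
    moreover obtain n where "norm x \<le> real n"
      using real_arch_simple by blast
    then have "norm x \<le> real (Suc n)"
      by simp
    ultimately show ?thesis
      unfolding P_def by blast
  qed
  then have "(\<Union>n. P (real (Suc n))) = UNIV"
    by blast
  then obtain n a where "a \<in> interior (closure (P (real (Suc n))))"
    using Baire_countable_cover by blast
  then obtain r where r: "r > 0" "ball a r \<subseteq> closure (P (real (Suc n)))"
    by (meson mem_interior)
  define k where "k = 4 * real (Suc n) / r"
  have "k > 0"
    using r(1) by (simp add: k_def)
  then have "lifts_modulo T M (2 * k)"
    using approx_lifts_modulo_if_ball_subset_closure[OF M(1) r(2)[unfolded P_def] r(1)]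
    by (intro lifts_modulo_if_approx_lifts_modulo[OF M]) (simp_all add: k_def)
  then show thesis
    using that[of "2 * k"] \<open>k > 0\<close> by simp
qed

lemma lifts_modulo_dist_kernel:
  assumes T: "lifts_modulo T M K" and trivial: "range (blinfun_apply T) \<inter> M = {0}"
  obtains v where "v \<in> blinfun_kernel T" "norm (u - v) \<le> K * norm (T u)"
proof -
  obtain x where x: "T u - T x \<in> M" "norm x \<le> K * norm (T u)"
    using T by (rule lifts_moduloE)
  have "T (u - x) \<in> M"
    using x(1) by (simp add: blinfun.diff_right)
  then have "u - x \<in> blinfun_kernel T"
    using trivial by (auto simp: blinfun_kernel_def)
  then show thesis
    using that[of "u - x"] x(2) by simp
qed

lemma lifts_modulo_norm_le_norm_add:
  assumes T: "lifts_modulo T M K" and M: "subspace M" "m \<in> M"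
    and trivial: "range (blinfun_apply T) \<inter> M = {0}"
  shows "norm (T x) \<le> norm T * (K * norm (T x + m))"
proof -
  obtain h where h: "T x + m - T h \<in> M" "norm h \<le> K * norm (T x + m)"
    using T by (rule lifts_moduloE)
  have "T (x - h) \<in> M"
    using subspace_diff[OF M(1) h(1) M(2)] by (simp add: blinfun.diff_right)
  then have "T (x - h) = 0"
    using trivial by blast
  then have "T x = T h"
    by (simp add: blinfun.diff_right)
  then show ?thesis
    using norm_blinfun[of T h] mult_left_mono[OF h(2), of "norm T"] by simp
qed

lemma closed_range_if_complemented:
  assumes T: "lifts_modulo T M K" and M: "subspace M"
    and trivial: "range (blinfun_apply T) \<inter> M = {0}"
  shows "closed (range (blinfun_apply T))"
  unfolding closed_sequential_limits
proof (intro allI impI, elim conjE)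
  fix s l
  assume "\<forall>n. s n \<in> range (blinfun_apply T)" and lim: "s \<longlonglongrightarrow> l"
  then have "\<forall>n. \<exists>v. s n = T v"
    by blast
  then obtain w where w: "\<And>n. s n = T (w n)"
    by metis
  obtain x where x: "l - T x \<in> M"
    using T by (rule lifts_moduloE)
  have "norm (s n - T x) \<le> norm T * (K * norm (s n - l))" for n
    using lifts_modulo_norm_le_norm_add[OF T M subspace_neg[OF M x] trivial, of "w n - x"]
    by (simp add: w blinfun.diff_right)
  moreover have "(\<lambda>n. norm T * (K * norm (s n - l))) \<longlonglongrightarrow> 0"
    using lim by (intro tendsto_mult_right_zero tendsto_norm_zero LIM_zero)
  ultimately have "(\<lambda>n. s n - T x) \<longlonglongrightarrow> 0"
    by (intro Lim_null_comparison[of "\<lambda>n. s n - T x"]) auto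
  then have "s \<longlonglongrightarrow> T x"
    by (rule LIM_zero_cancel)
  then have "l = T x"
    by (rule LIMSEQ_unique[OF lim])
  then show "l \<in> range (blinfun_apply T)"
    by simp
qed

section \<open>Fredholm operators\<close>

lemma subspace_blinfun_kernel: "subspace (blinfun_kernel T)"
  by (auto simp: subspace_def blinfun_kernel_def blinfun.add_right blinfun.scaleR_right)

lemma subspace_range_blinfun: "subspace (range (blinfun_apply T))"
  by (simp add: linear_subspace_image bounded_linear.linear blinfun.bounded_linear_right)

lemma span_range_blinfun_Un_eq_UNIV_iff:
  "span (range (blinfun_apply T) \<union> C) = UNIV \<longleftrightarrow> (\<forall>y. \<exists>x. y - T x \<in> span C)"
proof -
  have "span (range (blinfun_apply T) \<union> C) = {T x + c | x c. c \<in> span C}"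
    unfolding span_Un span_eq_iff[THEN iffD2, OF subspace_range_blinfun] by auto
  moreover have "y \<in> {T x + c | x c. c \<in> span C} \<longleftrightarrow> (\<exists>x. y - T x \<in> span C)" for y
    by (simp, metis add_diff_cancel_left' diff_add_cancel)
  ultimately show ?thesis
    by blast
qed

lemma finite_cokernel_complement:
  fixes T :: "'a::banach \<Rightarrow>\<^sub>L 'b::banach"
  assumes "finite C" "span (range (blinfun_apply T) \<union> C) = UNIV"
  obtains D K where "finite D" "range (blinfun_apply T) \<inter> span D = {0}"
    "K > 0" "lifts_modulo T (span D) K"
proof -
  obtain D where D: "D \<subseteq> C" "span (range (blinfun_apply T) \<union> D) = UNIV"
    "range (blinfun_apply T) \<inter> span D = {0}"
    using assms by (rule complement_subset_of_finite_spanning_set[OF _ _ subspace_range_blinfun])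
  have "finite D"
    using D(1) assms(1) by (rule finite_subset)
  have onto: "\<exists>x. y - T x \<in> span D" for y
    using D(2) unfolding span_range_blinfun_Un_eq_UNIV_iff by blast
  obtain K where "K > 0" "lifts_modulo T (span D) K"
    using onto
    by (rule open_mapping_modulo_subspace[OF subspace_span closed_span_finite[OF \<open>finite D\<close>]])
  with \<open>finite D\<close> D(3) show thesis
    by (rule that)
qed

lemma fredholmE:
  fixes T :: "'a::banach \<Rightarrow>\<^sub>L 'b::banach"
  assumes "fredholm T"
  obtains B D K where "finite B" "span B = blinfun_kernel T"
    "finite D" "range (blinfun_apply T) \<inter> span D = {0}" "K > 0" "lifts_modulo T (span D) K"
proof -
  obtain B C where B: "finite B" "span B = blinfun_kernel T"
    and C: "finite C" "span (range (blinfun_apply T) \<union> C) = UNIV"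
    using assms unfolding fredholm_def by (elim conjE exE) (rule that)
  from C show thesis
    by (rule finite_cokernel_complement) (rule that[OF B])
qed

lemma finite_dim_kernel_perturb:
  fixes S T :: "'a::{real_inner,banach} \<Rightarrow>\<^sub>L 'b::real_normed_vector"
  assumes B: "finite B" "span B = blinfun_kernel T"
    and T: "lifts_modulo T M K" "range (blinfun_apply T) \<inter> M = {0}" "K \<ge> 0"
    and small: "norm (S - T) * K < 1"
  shows "\<exists>E. finite E \<and> span E = blinfun_kernel S"
proof (rule finite_dim_if_close_to_finite_span[OF subspace_blinfun_kernel B(1)])
  fix u
  assume u: "u \<in> blinfun_kernel S" "u \<noteq> 0"
  obtain v where v: "v \<in> span B" "norm (u - v) \<le> K * norm (T u)"
    using T(1,2) unfolding B(2) by (rule lifts_modulo_dist_kernel)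
  have "T u = - ((S - T) u)"
    using u(1) by (simp add: blinfun_kernel_def blinfun.diff_left)
  then have "norm (T u) \<le> norm (S - T) * norm u"
    by (metis norm_blinfun norm_minus_cancel)
  then have "K * norm (T u) \<le> (norm (S - T) * K) * norm u"
    using mult_left_mono[OF _ T(3)] by (fastforce simp: mult_ac)
  also have "\<dots> < norm u"
    using small u(2) by simp
  finally show "\<exists>v\<in>span B. norm (u - v) < norm u"
    using v by force
qed

lemma open_fredholm: "open {T :: 'a::{real_inner,banach} \<Rightarrow>\<^sub>L 'b::banach. fredholm T}"
  unfolding open_dist
proof (intro ballI, elim CollectE)
  fix T :: "'a \<Rightarrow>\<^sub>L 'b"
  assume "fredholm T"
  then obtain B D K where B: "finite B" "span B = blinfun_kernel T"
    and D: "finite D" "range (blinfun_apply T) \<inter> span D = {0}"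
    and K: "K > 0" "lifts_modulo T (span D) K"
    by (rule fredholmE)
  have "fredholm S" if "dist S T < 1 / (2 * K)" for S
  proof -
    have small: "norm (S - T) * K < 1 / 2"
      using that K(1) by (simp add: dist_norm field_simps)
    then have "\<exists>E. finite E \<and> span E = blinfun_kernel S"
      using K(1) by (intro finite_dim_kernel_perturb[OF B K(2) D(2)]) simp_all
    moreover have "lifts_modulo S (span D) (2 * K)"
      using K(1) small
      by (intro lifts_modulo_perturb[OF subspace_span closed_span_finite[OF D(1)] K(2)]) simp_all
    then have cokernel: "span (range (blinfun_apply S) \<union> D) = UNIV"
      unfolding span_range_blinfun_Un_eq_UNIV_iff lifts_modulo_def by blast
    moreover have "closed (range (blinfun_apply S))"
      using D(1) cokernel
      by (rule finite_cokernel_complement) (rule closed_range_if_complemented[OF _ subspace_span])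
    ultimately show ?thesis
      unfolding fredholm_def using D(1) by blast
  qed
  then show "\<exists>e>0. \<forall>S. dist S T < e \<longrightarrow> S \<in> {T. fredholm T}"
    using K(1) by (intro exI[of _ "1 / (2 * K)"]) simp
qed

lemma fredholm_unit_kernel_limit:
  fixes T :: "'a::banach \<Rightarrow>\<^sub>L 'b::banach"
  assumes "fredholm T" and lim: "S \<longlonglongrightarrow> T"
    and ker: "\<And>n. S n (u n) = 0" and unit: "\<And>n. norm (u n) = 1"
  obtains l r where "strict_mono r" "(u \<circ> r) \<longlonglongrightarrow> l" "T l = 0" "norm l = 1"
proof -
  obtain B D K where B: "finite B" "span B = blinfun_kernel T"
    and D: "range (blinfun_apply T) \<inter> span D = {0}" and K: "K > 0" "lifts_modulo T (span D) K"
    using assms(1) by (rule fredholmE)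
  have "\<exists>v. v \<in> span B \<and> norm (u n - v) \<le> K * norm (S n - T)" for n
  proof -
    obtain v where v: "v \<in> span B" "norm (u n - v) \<le> K * norm (T (u n))"
      using K(2) D unfolding B(2) by (rule lifts_modulo_dist_kernel)
    have "norm (T (u n)) \<le> norm (S n - T)"
      using norm_blinfun[of "S n - T" "u n"] by (simp add: ker unit blinfun.diff_left)
    then have "K * norm (T (u n)) \<le> K * norm (S n - T)"
      using K(1) by simp
    with v show ?thesis
      by (blast intro: order_trans)
  qed
  then obtain v where v: "\<And>n. v n \<in> span B" "\<And>n. norm (u n - v n) \<le> K * norm (S n - T)"
    by metis
  have "(\<lambda>n. K * norm (S n - T)) \<longlonglongrightarrow> 0"
    using lim by (intro tendsto_mult_right_zero tendsto_norm_zero LIM_zero)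
  then have near: "(\<lambda>n. u n - v n) \<longlonglongrightarrow> 0"
    by (rule Lim_null_comparison[rotated]) (simp add: v(2))
  obtain l r where l: "l \<in> span B" and r: "strict_mono r" "(u \<circ> r) \<longlonglongrightarrow> l"
    using bounded_sequence_near_finite_span_subsequence[OF B(1) v(1) _ near] unit
    by (metis order_refl)
  have "norm l = 1"
    using tendsto_norm[OF r(2)] unit by (simp add: o_def LIMSEQ_const_iff)
  moreover have "T l = 0"
    using l unfolding B(2) by (simp add: blinfun_kernel_def)
  ultimately show thesis
    using that r by blast
qed

section \<open>Null sets\<close>

lemma negligible_image_zero_derivative:
  fixes f :: "real \<Rightarrow> real"
  assumes "\<And>t. t \<in> S \<Longrightarrow> (f has_derivative (\<lambda>_. 0)) (at t within S)"
  shows "negligible (f ` S)"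
proof -
  let ?g = "\<lambda>x::real^1. vec (f (x $ 1)) :: real^1" and ?S = "vec ` S :: (real^1) set"
  have "(?g has_derivative (\<lambda>_. 0)) (at (vec t) within ?S)" if "t \<in> S" for t
  proof -
    have "(f has_derivative (\<lambda>x. x * 0)) (at t within S)"
      using assms[OF that] by simp
    moreover have "(*\<^sub>R) 0 = (\<lambda>_::real^1. 0 :: real^1)"
      by (simp add: fun_eq_iff)
    ultimately show ?thesis
      using has_derivative_vector_1[of f "\<lambda>_. 0" t S] by simp
  qed
  moreover have "matrix (\<lambda>_::real^1. 0 :: real^1) = 0"
    by (simp add: matrix_def vec_eq_iff)
  ultimately have "negligible (?g ` ?S)"
    by (intro baby_Sard[where f' = "\<lambda>_ _. 0"]) auto
  then have "negligible ((\<lambda>x::real^1. x $ 1) ` (?g ` ?S))"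
  proof (rule negligible_locally_Lipschitz_image[rotated])
    fix x :: "real^1"
    show "\<exists>T B. open T \<and> x \<in> T \<and> (\<forall>y\<in>(?g ` ?S) \<inter> T. norm (y $ 1 - x $ 1) \<le> B * norm (y - x))"
      by (intro exI[of _ UNIV] exI[of _ 1])
        (auto simp flip: vector_minus_component intro: component_le_norm_cart)
  qed simp
  then show ?thesis
    by (simp add: image_image)
qed

lemma negligible_image_zero_derivative_if_inverse_Lipschitz:
  fixes P :: "'a::real_normed_vector set" and g h :: "'a \<Rightarrow> real"
  assumes der: "\<And>p. p \<in> P \<Longrightarrow> (g has_derivative (\<lambda>_. 0)) (at p within P)"
    and "L > 0" and lip: "\<And>p q. p \<in> P \<Longrightarrow> q \<in> P \<Longrightarrow> norm (q - p) \<le> L * \<bar>h q - h p\<bar>"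
  shows "negligible (g ` P)"
proof -
  define f where "f = g \<circ> inv_into P h"
  have "inj_on h P"
    using lip by (intro inj_onI) fastforce
  then have f: "f (h p) = g p" if "p \<in> P" for p
    using that by (simp add: f_def)
  have "(f has_derivative (\<lambda>_. 0)) (at (h p) within h ` P)" if p: "p \<in> P" for p
    unfolding has_derivative_within_alt
  proof (intro conjI allI impI)
    fix e :: real
    assume "e > 0"
    then have "e / L > 0"
      using \<open>L > 0\<close> by simp
    then obtain r where r: "r > 0"
      "\<And>q. q \<in> P \<Longrightarrow> norm (q - p) < r \<Longrightarrow> \<bar>g q - g p\<bar> \<le> e / L * norm (q - p)"
      using der[OF p] unfolding has_derivative_within_alt by fastforce
    have "norm (f (h q) - f (h p) - 0) \<le> e * norm (h q - h p)"
      if q: "q \<in> P" "norm (h q - h p) < r / L" for q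
    proof -
      have "norm (q - p) < r"
        using lip[OF p q(1)] q(2) \<open>L > 0\<close> by (simp add: field_simps)
      then have "\<bar>g q - g p\<bar> \<le> e / L * norm (q - p)"
        by (rule r(2)[OF q(1)])
      also have "\<dots> \<le> e / L * (L * \<bar>h q - h p\<bar>)"
        using lip[OF p q(1)] \<open>e / L > 0\<close> by (intro mult_left_mono) auto
      finally show ?thesis
        using \<open>L > 0\<close> f p q(1) by simp
    qed
    then show "\<exists>d>0. \<forall>s\<in>h ` P. norm (s - h p) < d \<longrightarrow> norm (f s - f (h p) - 0) \<le> e * norm (s - h p)"
      using r(1) \<open>L > 0\<close> by (intro exI[of _ "r / L"]) auto
  qed simp
  then have "negligible (f ` h ` P)"
    by (intro negligible_image_zero_derivative) auto
  also have "f ` h ` P = g ` P"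
    using f by (simp add: image_image)
  finally show ?thesis .
qed

lemma countable_dist_dense_set:
  obtains D :: "'a::{metric_space,second_countable_topology} set"
  where "countable D" "\<forall>e>0. \<forall>p. \<exists>c\<in>D. dist c p < e"
proof -
  obtain D :: "'a set" where D: "countable D" "\<And>U. open U \<Longrightarrow> U \<noteq> {} \<Longrightarrow> \<exists>d\<in>D. d \<in> U"
    using countable_dense_exists by blast
  have "\<forall>e>0. \<forall>p. \<exists>c\<in>D. dist c p < e"
    using D(2)[of "ball _ _"] by (auto simp: dist_commute)
  with D(1) show thesis
    by (rule that)
qed

lemma countable_cover_if_locally_related:
  fixes G :: "'a::{metric_space,second_countable_topology} set"
  assumes "\<And>p. p \<in> G \<Longrightarrow> \<exists>r>0. \<forall>q\<in>G. dist q p < r \<longrightarrow> R p q"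
  obtains \<P> where "countable \<P>" "\<Union>\<P> = G" "\<forall>P\<in>\<P>. \<forall>p\<in>P. \<forall>q\<in>P. R p q"
proof -
  obtain D :: "'a set" where D: "countable D" "\<forall>e>0. \<forall>p. \<exists>c\<in>D. dist c p < e"
    by (rule countable_dist_dense_set)
  define \<rho> where "\<rho> n = inverse (real (Suc n))" for n
  define P where "P n c = {p \<in> G \<inter> ball c (\<rho> n / 2). \<forall>q\<in>G. dist q p < \<rho> n \<longrightarrow> R p q}" for n c
  have "\<exists>n. \<exists>c\<in>D. p \<in> P n c" if p: "p \<in> G" for p
  proof -
    obtain r where r: "r > 0" "\<forall>q\<in>G. dist q p < r \<longrightarrow> R p q"
      using assms[OF p] by blast
    obtain n where "\<rho> n < r"
      unfolding \<rho>_def using reals_Archimedean[OF r(1)] by blast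
    moreover have "\<rho> n / 2 > 0"
      by (simp add: \<rho>_def)
    moreover from this obtain c where "c \<in> D" "dist c p < \<rho> n / 2"
      using D(2) by blast
    ultimately show ?thesis
      using p r(2) by (force simp: P_def)
  qed
  then have "\<Union>(\<Union>n. P n ` D) = G"
    by (fastforce simp: P_def)
  moreover have "\<forall>X\<in>(\<Union>n. P n ` D). \<forall>p\<in>X. \<forall>q\<in>X. R p q"
  proof (intro ballI)
    fix X p q
    assume X: "X \<in> (\<Union>n. P n ` D)" and pq: "p \<in> X" "q \<in> X"
    obtain n c where "X = P n c"
      using X by blast
    with pq have "dist q p < \<rho> n"
      using dist_triangle2[of q p c] by (auto simp: P_def dist_commute)
    then show "R p q"
      using pq \<open>X = P n c\<close> by (auto simp: P_def)
  qed
  moreover have "countable (\<Union>n. P n ` D)"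
    using D(1) by simp
  ultimately show thesis
    using that[of "\<Union>n. P n ` D"] by simp
qed

text \<open>
  For \<open>snd\<close> replaced by an arbitrary \<open>C\<^sup>1\<close> function on the plane this fails, by Whitney's example;
  here the hypothesis makes \<open>G\<close> locally a Lipschitz graph over the first coordinate.
\<close>

lemma negligible_snd_image_zero_derivative:
  fixes G :: "(real \<times> real) set"
  assumes der: "\<And>p. p \<in> G \<Longrightarrow> (snd has_derivative (\<lambda>_. 0)) (at p within G)"
  shows "negligible (snd ` G)"
proof -
  have "\<exists>r>0. \<forall>q\<in>G. dist q p < r \<longrightarrow> norm (q - p) \<le> 2 * \<bar>fst q - fst p\<bar>" if p: "p \<in> G" for p
  proof -
    have "(0::real) < 1 / 2"
      by simp
    then obtain r where r: "r > 0"
      "\<forall>q\<in>G. norm (q - p) < r \<longrightarrow> norm (snd q - snd p - 0) \<le> 1 / 2 * norm (q - p)"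
      using der[OF p] unfolding has_derivative_within_alt by blast
    have "norm (q - p) \<le> 2 * \<bar>fst q - fst p\<bar>" if "q \<in> G" "dist q p < r" for q
    proof -
      have "norm (q - p) \<le> \<bar>fst q - fst p\<bar> + \<bar>snd q - snd p\<bar>"
        by (simp add: norm_prod_def sqrt_sum_squares_le_sum_abs)
      moreover have "\<bar>snd q - snd p\<bar> \<le> 1 / 2 * norm (q - p)"
        using r(2) that by (simp add: dist_norm)
      ultimately show ?thesis
        by simp
    qed
    with r(1) show ?thesis
      by blast
  qed
  then obtain \<P> where \<P>: "countable \<P>" "\<Union>\<P> = G"
    and lip: "\<forall>P\<in>\<P>. \<forall>p\<in>P. \<forall>q\<in>P. norm (q - p) \<le> 2 * \<bar>fst q - fst p\<bar>"
    by (rule countable_cover_if_locally_related)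
  have "negligible (snd ` P)" if "P \<in> \<P>" for P
  proof (rule negligible_image_zero_derivative_if_inverse_Lipschitz[where h = fst and L = 2])
    show "(snd has_derivative (\<lambda>_. 0)) (at p within P)" if "p \<in> P" for p
      using der[of p] \<P>(2) \<open>P \<in> \<P>\<close> that by (blast intro: has_derivative_subset)
  qed (use lip that in simp_all)
  then have "negligible (\<Union>((`) snd ` \<P>))"
    using \<P>(1) by (intro negligible_countable_Union) auto
  moreover have "\<Union>((`) snd ` \<P>) = snd ` G"
    using \<P>(2) by blast
  ultimately show ?thesis
    by simp
qed

section \<open>Differentiable families of operators\<close>

lemma tendsto_at_within_if_subsequence:
  fixes f :: "'a::first_countable_topology \<Rightarrow> 'b::topological_space"
  assumes "\<And>X. (\<And>n. X n \<in> S - {x}) \<Longrightarrow> X \<longlonglongrightarrow> x \<Longrightarrow> \<exists>r. strict_mono r \<and> (\<lambda>n. f (X (r n))) \<longlonglongrightarrow> L"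
  shows "(f \<longlongrightarrow> L) (at x within S)"
  unfolding tendsto_at_iff_sequentially
proof (intro allI impI topological_tendstoI)
  fix X U
  assume X: "\<forall>n. X n \<in> S - {x}" "X \<longlonglongrightarrow> x" and U: "open U" "L \<in> U"
  show "\<forall>\<^sub>F n in sequentially. (f \<circ> X) n \<in> U"
  proof (rule ccontr)
    assume "\<not> ?thesis"
    then obtain r where r: "strict_mono (r :: nat \<Rightarrow> nat)" "\<forall>n. (f \<circ> X) (r n) \<notin> U"
      by (blast dest: not_eventually_sequentiallyD)
    obtain s where "(\<lambda>n. f ((X \<circ> r) (s n))) \<longlonglongrightarrow> L"
      using assms[of "X \<circ> r"] X(1) LIMSEQ_subseq_LIMSEQ[OF X(2) r(1)] by auto
    then have "\<forall>\<^sub>F n in sequentially. f ((X \<circ> r) (s n)) \<in> U"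
      using U by (rule topological_tendstoD)
    then show False
      using r(2) by simp
  qed
qed

lemma tendsto_zero_if_mult_tendsto_zero:
  fixes f g :: "'a \<Rightarrow> 'b::real_normed_field"
  assumes "((\<lambda>x. f x * g x) \<longlongrightarrow> 0) F" and g: "(g \<longlongrightarrow> c) F" "c \<noteq> 0"
  shows "(f \<longlongrightarrow> 0) F"
proof (rule Lim_transform_eventually)
  show "((\<lambda>x. f x * g x / g x) \<longlongrightarrow> 0) F"
    using tendsto_divide[OF assms] by simp
  show "\<forall>\<^sub>F x in F. f x * g x / g x = f x"
    using tendsto_imp_eventually_ne[OF g] by eventually_elim simp
qed

lemma kernel_family_derivative_pairing:
  fixes F :: "'p::real_normed_vector \<Rightarrow> 'a::real_normed_vector \<Rightarrow>\<^sub>L 'b::real_inner"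
  assumes der: "(F has_derivative F') (at p within S)"
    and X: "\<And>n. X n \<in> S - {p}" "X \<longlonglongrightarrow> p"
    and ker: "\<And>n. F (X n) (u n) = 0" and "u \<longlonglongrightarrow> l" and annihilates: "\<And>v. F p v \<bullet> w = 0"
  shows "(\<lambda>n. F' (sgn (X n - p)) (u n) \<bullet> w) \<longlonglongrightarrow> 0"
proof -
  have linear: "F' (c *\<^sub>R z) = c *\<^sub>R F' z" for c z
    using der has_derivative_bounded_linear bounded_linear.linear linear_cmul by blast
  define Q where "Q q = (1 / norm (q - p)) *\<^sub>R (F q - (F p + F' (q - p)))" for q
  have "(Q \<longlongrightarrow> 0) (at p within S)"
    using der unfolding has_derivative_within Q_def by blast
  then have "(Q \<circ> X) \<longlonglongrightarrow> 0"
    using X unfolding tendsto_at_iff_sequentially by blast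
  then have "(\<lambda>n. - ((Q \<circ> X) n (u n) \<bullet> w)) \<longlonglongrightarrow> - (blinfun_apply 0 l \<bullet> w)"
    using \<open>u \<longlonglongrightarrow> l\<close> by (intro tendsto_minus tendsto_inner blinfun.tendsto tendsto_const)
  moreover have "- ((Q \<circ> X) n (u n) \<bullet> w) = F' (sgn (X n - p)) (u n) \<bullet> w" for n
    by (simp add: Q_def linear blinfun.scaleR_left blinfun.diff_left blinfun.add_left
        inner_diff_left inner_add_left ker annihilates sgn_div_norm divide_inverse)
  ultimately show ?thesis
    by simp
qed

section \<open>Selfadjoint Fredholm operators\<close>

lemma mem_adjoint_graph_op_graph_iff:
  "(v, z) \<in> adjoint_graph (op_graph j T) \<longleftrightarrow> (\<forall>u. T u \<bullet> v = j u \<bullet> z)"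
  by (force simp: adjoint_graph_def op_graph_def)

lemma selfadjoint_op_shift:
  assumes "selfadjoint_op j T"
  shows "selfadjoint_op j (T + \<delta> *\<^sub>R j)"
proof -
  have "(v, z) \<in> adjoint_graph (op_graph j (T + \<delta> *\<^sub>R j)) \<longleftrightarrow>
      (v, z - \<delta> *\<^sub>R v) \<in> adjoint_graph (op_graph j T)" for v z
    by (simp add: mem_adjoint_graph_op_graph_iff blinfun.add_left blinfun.scaleR_left
        inner_add_left inner_diff_right eq_diff_eq)
  moreover have "(v, z) \<in> op_graph j (T + \<delta> *\<^sub>R j) \<longleftrightarrow> (v, z - \<delta> *\<^sub>R v) \<in> op_graph j T" for v z
    by (auto simp: op_graph_def blinfun.add_left blinfun.scaleR_left algebra_simps)
  ultimately show ?thesis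
    using assms unfolding selfadjoint_op_def by auto
qed

lemma selfadjoint_op_range_orthogonal_kernel:
  assumes "selfadjoint_op j T" "T u = 0"
  shows "T v \<bullet> j u = 0"
proof -
  have "(j u, T u) \<in> adjoint_graph (op_graph j T)"
    using assms(1) by (auto simp: selfadjoint_op_def op_graph_def)
  then show ?thesis
    using assms(2) by (simp add: mem_adjoint_graph_op_graph_iff)
qed

lemma compact_FS_shift:
  fixes j :: "'w::{real_inner,banach} \<Rightarrow>\<^sub>L 'h::{real_inner,banach}"
  assumes "compact \<A>" "\<A> \<subseteq> FS j"
  obtains \<epsilon> where "\<epsilon> > 0" "\<And>T \<delta>. T \<in> \<A> \<Longrightarrow> \<bar>\<delta>\<bar> < \<epsilon> \<Longrightarrow> T + \<delta> *\<^sub>R j \<in> FS j"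
proof -
  obtain r where r: "r > 0" "(\<Union>T\<in>\<A>. ball T r) \<subseteq> {T. fredholm T}"
    using compact_subset_open_imp_ball_epsilon_subset[OF assms(1) open_fredholm] assms(2)
    unfolding FS_def by blast
  have "T + \<delta> *\<^sub>R j \<in> FS j" if "T \<in> \<A>" "\<bar>\<delta>\<bar> < r / (norm j + 1)" for T \<delta>
  proof -
    have "\<bar>\<delta>\<bar> * norm j \<le> \<bar>\<delta>\<bar> * (norm j + 1)"
      by (intro mult_left_mono) auto
    also have "\<dots> < r"
      using that(2) by (simp add: pos_less_divide_eq add_nonneg_pos)
    finally have "T + \<delta> *\<^sub>R j \<in> ball T r"
      by (simp add: dist_norm)
    with r(2) that(1) have "fredholm (T + \<delta> *\<^sub>R j)"
      by blast
    then show ?thesis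
      using assms(2) that(1) selfadjoint_op_shift unfolding FS_def by blast
  qed
  moreover have "r / (norm j + 1) > 0"
    using r(1) by (simp add: add_nonneg_pos)
  ultimately show thesis
    using that by blast
qed

section \<open>Isotropic crossings\<close>

lemma path_deriv_eqI:
  assumes "(A has_vector_derivative A') (at t within {0..1})" "t \<in> {0..1}"
  shows "path_deriv A t = A'"
  using vector_derivative_within_cbox[of 0 1 t A A'] assms by (simp add: path_deriv_def)

lemma C1_path_has_vector_derivative:
  assumes "C1_path A" "t \<in> {0..1}"
  shows "(A has_vector_derivative path_deriv A t) (at t within {0..1})"
  using assms path_deriv_eqI unfolding C1_path_def by metis

lemma C1_path_continuous_on_path_deriv:
  assumes "C1_path A"
  shows "continuous_on {0..1} (path_deriv A)"
proof -
  obtain A' where A': "\<And>t. t \<in> {0..1} \<Longrightarrow> (A has_vector_derivative A' t) (at t within {0..1})"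
    and "continuous_on {0..1} A'"
    using assms unfolding C1_path_def by blast
  from \<open>continuous_on {0..1} A'\<close> show ?thesis
    by (rule continuous_on_eq) (simp add: path_deriv_eqI[OF A'])
qed

lemma C1_path_imp_path:
  assumes "C1_path A"
  shows "path A"
  unfolding path_def continuous_on_eq_continuous_within
  using C1_path_has_vector_derivative[OF assms] has_vector_derivative_continuous by blast

lemma path_deriv_shift_path:
  assumes "C1_path A" "t \<in> {0..1}"
  shows "path_deriv (shift_path j A \<delta>) t = path_deriv A t"
proof (rule path_deriv_eqI[OF _ assms(2)])
  show "(shift_path j A \<delta> has_vector_derivative path_deriv A t) (at t within {0..1})"
    using has_vector_derivative_add[OF C1_path_has_vector_derivative[OF assms]
        has_vector_derivative_const]
    by (simp add: shift_path_def)
qed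

lemma shift_path_has_derivative:
  assumes "(A has_vector_derivative A') (at t within S)"
  shows "((\<lambda>q. shift_path j A (snd q) (fst q)) has_derivative (\<lambda>z. fst z *\<^sub>R A' + snd z *\<^sub>R j))
    (at (t, \<delta>) within S \<times> UNIV)"
proof -
  have "((A \<circ> fst) has_derivative ((\<lambda>x. x *\<^sub>R A') \<circ> fst)) (at (t, \<delta>) within S \<times> UNIV)"
    using assms unfolding has_vector_derivative_def
    by (intro diff_chain_within has_derivative_fst has_derivative_ident)
      (auto intro: has_derivative_subset)
  then show ?thesis
    unfolding shift_path_def by (auto intro!: derivative_eq_intros simp: o_def)
qed

lemma shift_path_kernel_direction:
  assumes der: "(A has_vector_derivative A') (at t within S)"
    and sa: "selfadjoint_op j (shift_path j A \<delta> t)"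
    and X: "\<And>n. X n \<in> S \<times> UNIV - {(t, \<delta>)}" "X \<longlonglongrightarrow> (t, \<delta>)"
    and ker: "\<And>n. shift_path j A (snd (X n)) (fst (X n)) (u n) = 0"
    and u: "u \<longlonglongrightarrow> l" and l: "shift_path j A \<delta> t l = 0" "A' l \<bullet> j l = 0" "j l \<noteq> 0"
  shows "(\<lambda>n. snd (sgn (X n - (t, \<delta>)))) \<longlonglongrightarrow> 0"
proof -
  define z where "z n = sgn (X n - (t, \<delta>))" for n
  have "shift_path j A (snd (t, \<delta>)) (fst (t, \<delta>)) v \<bullet> j l = 0" for v
    using selfadjoint_op_range_orthogonal_kernel[OF sa l(1)] by simp
  then have "(\<lambda>n. (fst (z n) *\<^sub>R A' + snd (z n) *\<^sub>R j) (u n) \<bullet> j l) \<longlonglongrightarrow> 0"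
    unfolding z_def
    by (rule kernel_family_derivative_pairing[OF shift_path_has_derivative[OF der] X ker u])
  then have pairing: "(\<lambda>n. fst (z n) * (A' (u n) \<bullet> j l) + snd (z n) * (j (u n) \<bullet> j l)) \<longlonglongrightarrow> 0"
    by (simp add: blinfun.add_left blinfun.scaleR_left inner_add_left)
  have "\<bar>fst (z n)\<bar> \<le> 1" for n
    using norm_fst_le[of "fst (z n)" "snd (z n)"] by (simp add: z_def norm_sgn split: if_splits)
  then have "\<forall>\<^sub>F n in sequentially. norm (fst (z n) * (A' (u n) \<bullet> j l)) \<le> \<bar>A' (u n) \<bullet> j l\<bar>"
    by (intro always_eventually) (simp add: abs_mult mult_left_le_one_le)
  moreover have "(\<lambda>n. A' (u n) \<bullet> j l) \<longlonglongrightarrow> A' l \<bullet> j l"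
    by (intro tendsto_inner blinfun.tendsto tendsto_const u)
  ultimately have "(\<lambda>n. fst (z n) * (A' (u n) \<bullet> j l)) \<longlonglongrightarrow> 0"
    unfolding l(2) by (rule Lim_null_comparison[OF _ tendsto_rabs_zero])
  from tendsto_diff[OF pairing this] have "(\<lambda>n. snd (z n) * (j (u n) \<bullet> j l)) \<longlonglongrightarrow> 0"
    by simp
  moreover have "(\<lambda>n. j (u n) \<bullet> j l) \<longlonglongrightarrow> j l \<bullet> j l"
    by (intro tendsto_inner blinfun.tendsto tendsto_const u)
  ultimately have "(\<lambda>n. snd (z n)) \<longlonglongrightarrow> 0"
    by (rule tendsto_zero_if_mult_tendsto_zero) (simp add: l(3))
  then show ?thesis
    unfolding z_def .
qed

definition isotropic_crossings ::
  "('w::real_inner \<Rightarrow>\<^sub>L 'h::real_inner) \<Rightarrow> (real \<Rightarrow> 'w \<Rightarrow>\<^sub>L 'h) \<Rightarrow> (real \<times> real) set" where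
  "isotropic_crossings j A =
     {(t, \<delta>). t \<in> {0..1} \<and> (\<exists>u. u \<noteq> 0 \<and> shift_path j A \<delta> t u = 0 \<and> crossing_form j A t u = 0)}"

lemma isotropic_crossing_unit_vector:
  assumes "(t, \<delta>) \<in> isotropic_crossings j A"
  obtains u where "norm u = 1" "shift_path j A \<delta> t u = 0" "crossing_form j A t u = 0"
proof -
  obtain u where u: "u \<noteq> 0" "shift_path j A \<delta> t u = 0" "crossing_form j A t u = 0"
    using assms unfolding isotropic_crossings_def by blast
  then show thesis
    using that[of "u /\<^sub>R norm u"] by (simp add: crossing_form_def blinfun.scaleR_right)
qed

lemma isotropic_crossings_kernel_limit:
  fixes j :: "'w::{real_inner,banach} \<Rightarrow>\<^sub>L 'h::{real_inner,banach}"
  assumes "C1_path A" and t: "t \<in> {0..1}" and "fredholm (shift_path j A \<delta> t)"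
    and X: "\<And>n. X n \<in> isotropic_crossings j A" "X \<longlonglongrightarrow> (t, \<delta>)"
  obtains r u l where "strict_mono r" "u \<longlonglongrightarrow> l"
    "\<And>n. shift_path j A (snd (X (r n))) (fst (X (r n))) (u n) = 0"
    "norm l = 1" "shift_path j A \<delta> t l = 0" "crossing_form j A t l = 0"
proof -
  have "\<exists>u. norm u = 1 \<and> shift_path j A (snd (X n)) (fst (X n)) u = 0 \<and>
      crossing_form j A (fst (X n)) u = 0" for n
    using isotropic_crossing_unit_vector[of "fst (X n)" "snd (X n)" j A] X(1)[of n]
    by (metis prod.collapse)
  then obtain u where unit: "\<And>n. norm (u n) = 1"
    and ker: "\<And>n. shift_path j A (snd (X n)) (fst (X n)) (u n) = 0"
    and isotropic: "\<And>n. crossing_form j A (fst (X n)) (u n) = 0"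
    by metis
  have t_lim: "(\<lambda>n. fst (X n)) \<longlonglongrightarrow> t" and \<delta>_lim: "(\<lambda>n. snd (X n)) \<longlonglongrightarrow> \<delta>"
    using tendsto_fst[OF X(2)] tendsto_snd[OF X(2)] by simp_all
  have "fst (X n) \<in> {0..1}" for n
    using X(1)[of n] by (auto simp: isotropic_crossings_def)
  then have t_mem: "\<forall>\<^sub>F n in sequentially. fst (X n) \<in> {0..1}"
    by (intro always_eventually allI)
  have "(\<lambda>n. shift_path j A (snd (X n)) (fst (X n))) \<longlonglongrightarrow> shift_path j A \<delta> t"
    unfolding shift_path_def using C1_path_imp_path[OF assms(1), unfolded path_def]
    by (intro tendsto_add tendsto_scaleR tendsto_const \<delta>_lim
        continuous_on_tendsto_compose[OF _ t_lim t t_mem])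
  then obtain r l where r: "strict_mono r" and u_lim: "(u \<circ> r) \<longlonglongrightarrow> l"
    and l: "shift_path j A \<delta> t l = 0" "norm l = 1"
    by (rule fredholm_unit_kernel_limit[OF assms(3) _ ker unit])
  have "(\<lambda>n. path_deriv A (fst (X n))) \<longlonglongrightarrow> path_deriv A t"
    using C1_path_continuous_on_path_deriv[OF assms(1)] t_lim t t_mem
    by (rule continuous_on_tendsto_compose)
  from LIMSEQ_subseq_LIMSEQ[OF this r]
  have "(\<lambda>n. crossing_form j A (fst (X (r n))) ((u \<circ> r) n)) \<longlonglongrightarrow> crossing_form j A t l"
    unfolding crossing_form_def
    by (intro tendsto_inner blinfun.tendsto u_lim tendsto_const) (simp add: o_def)
  then have "crossing_form j A t l = 0"
    by (simp add: isotropic LIMSEQ_const_iff)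
  then show thesis
    using that[OF r u_lim _ l(2) l(1)] ker by simp
qed

lemma isotropic_crossings_snd_has_derivative_zero:
  fixes j :: "'w::{real_inner,banach} \<Rightarrow>\<^sub>L 'h::{real_inner,banach}"
  assumes "inj (blinfun_apply j)" "C1_path A" "t \<in> {0..1}" "shift_path j A \<delta> t \<in> FS j"
  shows "(snd has_derivative (\<lambda>_. 0)) (at (t, \<delta>) within isotropic_crossings j A)"
proof -
  let ?G = "isotropic_crossings j A"
  have FS: "selfadjoint_op j (shift_path j A \<delta> t)" "fredholm (shift_path j A \<delta> t)"
    using assms(4) by (simp_all add: FS_def)
  have "((\<lambda>q. snd (sgn (q - (t, \<delta>)))) \<longlongrightarrow> 0) (at (t, \<delta>) within ?G)"
  proof (rule tendsto_at_within_if_subsequence)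
    fix X
    assume X: "\<And>n. X n \<in> ?G - {(t, \<delta>)}" "X \<longlonglongrightarrow> (t, \<delta>)"
    obtain r u l where r: "strict_mono r" and u: "u \<longlonglongrightarrow> l"
      "\<And>n. shift_path j A (snd (X (r n))) (fst (X (r n))) (u n) = 0"
      and l: "norm l = 1" "shift_path j A \<delta> t l = 0" "crossing_form j A t l = 0"
      using isotropic_crossings_kernel_limit[OF assms(2,3) FS(2) _ X(2)] X(1) by blast
    have "(\<lambda>n. snd (sgn (X (r n) - (t, \<delta>)))) \<longlonglongrightarrow> 0"
    proof (rule shift_path_kernel_direction[OF C1_path_has_vector_derivative[OF assms(2,3)] FS(1)])
      show "X (r n) \<in> {0..1} \<times> UNIV - {(t, \<delta>)}" for n
        using X(1)[of "r n"] by (auto simp: isotropic_crossings_def)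
      show "(\<lambda>n. X (r n)) \<longlonglongrightarrow> (t, \<delta>)"
        using LIMSEQ_subseq_LIMSEQ[OF X(2) r] by (simp add: o_def)
      show "path_deriv A t l \<bullet> j l = 0"
        using l(3) by (simp add: crossing_form_def)
      show "j l \<noteq> 0"
        using assms(1) l(1) by (metis blinfun.zero_right injD norm_zero zero_neq_one)
    qed (use u l(2) in auto)
    with r show "\<exists>r. strict_mono r \<and> (\<lambda>n. snd (sgn (X (r n) - (t, \<delta>)))) \<longlonglongrightarrow> 0"
      by blast
  qed
  then show ?thesis
    by (simp add: has_derivative_within sgn_div_norm divide_inverse)
qed

lemma regular_crossing_if_anisotropic:
  assumes "crossing A t" "\<And>u. A t u = 0 \<Longrightarrow> crossing_form j A t u = 0 \<Longrightarrow> u = 0"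
  shows "regular_crossing j A t"
  unfolding regular_crossing_def nondegenerate_on_def
proof (intro conjI ballI impI assms(1))
  fix u
  assume u: "u \<in> blinfun_kernel (A t)"
    and polar: "\<forall>v\<in>blinfun_kernel (A t). polar_form (crossing_form j A t) u v = 0"
  have "polar_form (crossing_form j A t) u u = crossing_form j A t u"
    by (simp add: polar_form_def crossing_form_def blinfun.add_right inner_add_left inner_add_right)
  with polar u have "crossing_form j A t u = 0"
    by auto
  then show "u = 0"
    using assms(2) u by (simp add: blinfun_kernel_def)
qed

lemma only_regular_crossings_shift_path:
  assumes "C1_path A" "\<delta> \<notin> snd ` isotropic_crossings j A"
  shows "only_regular_crossings j (shift_path j A \<delta>)"
  unfolding only_regular_crossings_def
proof (intro allI impI)
  fix t
  assume crossing: "crossing (shift_path j A \<delta>) t"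
  then have t: "t \<in> {0..1}"
    by (simp add: crossing_def)
  have "(t, \<delta>) \<notin> isotropic_crossings j A"
    using assms(2) by force
  then show "regular_crossing j (shift_path j A \<delta>) t"
    using t crossing path_deriv_shift_path[OF assms(1) t]
    by (intro regular_crossing_if_anisotropic)
      (auto simp: isotropic_crossings_def crossing_form_def)
qed

lemma AE_only_regular_crossings_shift_path:
  fixes j :: "'w::{real_inner,banach} \<Rightarrow>\<^sub>L 'h::{real_inner,banach}"
  assumes "inj (blinfun_apply j)" "C1_path A"
    and FS: "\<And>t \<delta>. t \<in> {0..1} \<Longrightarrow> \<delta> \<in> J \<Longrightarrow> shift_path j A \<delta> t \<in> FS j"
  shows "AE \<delta> in lebesgue. \<delta> \<in> J \<longrightarrow> only_regular_crossings j (shift_path j A \<delta>)"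
proof -
  define G where "G = {q \<in> isotropic_crossings j A. snd q \<in> J}"
  have "(snd has_derivative (\<lambda>_. 0)) (at (t, \<delta>) within G)" if "(t, \<delta>) \<in> G" for t \<delta>
  proof (rule has_derivative_subset)
    show "(snd has_derivative (\<lambda>_. 0)) (at (t, \<delta>) within isotropic_crossings j A)"
      using that by (intro isotropic_crossings_snd_has_derivative_zero assms(1,2) FS)
        (auto simp: G_def isotropic_crossings_def)
  qed (auto simp: G_def)
  then have "negligible (snd ` G)"
    by (intro negligible_snd_image_zero_derivative) auto
  then have "snd ` G \<in> null_sets lebesgue"
    by (simp add: negligible_iff_null_sets)
  then show ?thesis
  proof (rule eventually_mono[OF AE_not_in], intro impI)
    fix \<delta>
    assume "\<delta> \<notin> snd ` G" "\<delta> \<in> J"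
    then show "only_regular_crossings j (shift_path j A \<delta>)"
      by (intro only_regular_crossings_shift_path[OF assms(2)]) (force simp: G_def)
  qed
qed

theorem theorem2p6:
  fixes j :: "'w::{real_inner,banach} \<Rightarrow>\<^sub>L 'h::{real_inner,banach}"
    and A :: "real \<Rightarrow> 'w \<Rightarrow>\<^sub>L 'h"
  assumes "inj (blinfun_apply j)"
    and "closure (range (blinfun_apply j)) = UNIV"
    and "C1_path A"
    and "path_image A \<subseteq> FS j"
  shows "\<exists>\<epsilon>>0.
           (\<forall>\<delta>. \<bar>\<delta>\<bar> < \<epsilon> \<longrightarrow> path (shift_path j A \<delta>) \<and> path_image (shift_path j A \<delta>) \<subseteq> FS j) \<and>
           (AE \<delta> in lebesgue. \<delta> \<in> {-\<epsilon><..<\<epsilon>} \<longrightarrow> only_regular_crossings j (shift_path j A \<delta>))"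
proof -
  have "path A"
    using assms(3) by (rule C1_path_imp_path)
  then obtain \<epsilon> where "\<epsilon> > 0" and shift: "\<And>T \<delta>. T \<in> path_image A \<Longrightarrow> \<bar>\<delta>\<bar> < \<epsilon> \<Longrightarrow> T + \<delta> *\<^sub>R j \<in> FS j"
    using compact_FS_shift[OF compact_path_image assms(4)] by metis
  have FS: "shift_path j A \<delta> t \<in> FS j" if "t \<in> {0..1}" "\<bar>\<delta>\<bar> < \<epsilon>" for t \<delta>
    using shift that by (simp add: shift_path_def path_image_def)
  have "path (shift_path j A \<delta>)" for \<delta>
    using \<open>path A\<close> unfolding path_def shift_path_def by (intro continuous_intros)
  moreover have "path_image (shift_path j A \<delta>) \<subseteq> FS j" if "\<bar>\<delta>\<bar> < \<epsilon>" for \<delta>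
    using FS that by (auto simp: path_image_def)
  moreover have "AE \<delta> in lebesgue. \<delta> \<in> {-\<epsilon><..<\<epsilon>} \<longrightarrow> only_regular_crossings j (shift_path j A \<delta>)"
    using FS by (intro AE_only_regular_crossings_shift_path assms(1,3)) auto
  ultimately show ?thesis
    using \<open>\<epsilon> > 0\<close> by blast
qed

end
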